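(* Let $H(s)=C(s)K(s)^{-1}B(s)$, let $F_{2r}$ be the backward perturbation matrix of the Petrov-Galerkin inexact solves (see context), and let $\widetilde H(s)=C(s)(K(s)-F_{2r})^{-1}B(s)$. If $\|F_{2r}\|<1/\|K(s)^{-1}\|_{\mathcal H_\infty}$, then $$\|H-\widetilde H\|_{\mathcal H_2}\le\frac{\|C(s)K(s)^{-1}\|_{\mathcal H_2}\,\|K(s)^{-1}B(s)\|_{\mathcal H_\infty}}{1-\|K(s)^{-1}\|_{\mathcal H_\infty}\,\|F_{2r}\|}\,\|F_{2r}\| .$$
   Context: $K(s)\in\mathbb{C}^{n\times n}$, $B(s)\in\mathbb{C}^{n\times m}$, $C(s)\in\mathbb{C}^{p\times n}$ are matrix-valued functions, analytic in the right half plane and defined (continuous) on the imaginary axis, with $K$ nonsingular there; the $\mathcal H_2$ and $\mathcal H_\infty$ norms on the right-hand side are assumed finite. $\|\cdot\|$ is the Euclidean / spectral norm, $\|\cdot\|_F$ the Frobenius norm, and $$\|G\|_{\mathcal H_2}=\left(\frac1{2\pi}\int_{-\infty}^\infty\|G(\imath\omega)\|_F^2\,d\omega\right)^{1/2},\qquad \|G\|_{\mathcal H_\infty}=\sup_{\omega\in\mathbb{R}}\|G(\imath\omega)\|.$$ Definition of $F_{2r}$: given interpolation points $\sigma_1,\dots,\sigma_r\in\mathbb{C}$ (with $K(\sigma_j)$ nonsingular) and directions $b_j\in\mathbb{C}^m$, $c_j\in\mathbb{C}^p$, let $\mathcal P_N,\mathcal Q_N$ be $N$-dimensional subspaces of $\mathbb{C}^n$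 with $(K(\sigma_j)\mathcal P_N)^\perp\cap\mathcal Q_N=\{0\}$ for all $j$; let $\widetilde v_j\in\mathcal P_N$ be such that $\eta_j=K(\sigma_j)\widetilde v_j-B(\sigma_j)b_j\perp\mathcal Q_N$ and $\widetilde w_j\in\mathcal Q_N$ be such that $\xi_j=K(\sigma_j)^T\widetilde w_j-C(\sigma_j)^Tc_j\perp\mathcal P_N$ ($\perp$ with respect to the unconjugated pairing $x^Ty$). Put $\widetilde V_r=[\widetilde v_1,\dots,\widetilde v_r]$, $\widetilde W_r=[\widetilde w_1,\dots,\widetilde w_r]$, $R_b=[\eta_1,\dots,\eta_r]$, $R_c=[\xi_1,\dots,\xi_r]$, assume $\widetilde W_r^T\widetilde V_r$ nonsingular, and set $$F_{2r}=R_b(\widetilde W_r^T\widetilde V_r)^{-1}\widetilde W_r^T+\widetilde V_r(\widetilde W_r^T\widetilde V_r)^{-1}R_c^T.$$ *)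

theory Defs
  imports "HOL-Analysis.Analysis"
begin

definition spectral_norm :: "complex^'b^'a \<Rightarrow> real" where
  "spectral_norm A = onorm ((*v) A)"

definition frobenius_norm :: "complex^'b^'a \<Rightarrow> real" where
  "frobenius_norm A = sqrt (\<Sum>i\<in>UNIV. \<Sum>j\<in>UNIV. (cmod (A $ i $ j))\<^sup>2)"

text \<open>
  The real-valued norms below are only meaningful together with the corresponding finiteness
  predicate: the Bochner integral of a non-integrable function is \<open>0\<close>, and the supremum of an
  unbounded set of reals is unspecified.
\<close>

definition H2_finite :: "(complex \<Rightarrow> complex^'b^'a) \<Rightarrow> bool" where
  "H2_finite G \<longleftrightarrow> integrable lborel (\<lambda>\<omega>::real. (frobenius_norm (G (\<i> * of_real \<omega>)))\<^sup>2)"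

definition H2_norm :: "(complex \<Rightarrow> complex^'b^'a) \<Rightarrow> real" where
  "H2_norm G =
     sqrt (1 / (2 * pi) * (LINT \<omega>::real|lborel. (frobenius_norm (G (\<i> * of_real \<omega>)))\<^sup>2))"

definition Hinf_finite :: "(complex \<Rightarrow> complex^'b^'a) \<Rightarrow> bool" where
  "Hinf_finite G \<longleftrightarrow> bdd_above (range (\<lambda>\<omega>::real. spectral_norm (G (\<i> * of_real \<omega>))))"

definition Hinf_norm :: "(complex \<Rightarrow> complex^'b^'a) \<Rightarrow> real" where
  "Hinf_norm G = (SUP \<omega>::real. spectral_norm (G (\<i> * of_real \<omega>)))"

text \<open>Analyticity of a matrix-valued function is entrywise.\<close>

definition analytic_rhp_cont_axis :: "(complex \<Rightarrow> complex^'b^'a) \<Rightarrow> bool" where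
  "analytic_rhp_cont_axis G \<longleftrightarrow>
     (\<forall>i j. (\<lambda>s. G s $ i $ j) analytic_on {s. Re s > 0}) \<and> continuous_on {s. Re s = 0} G"

definition transfer_function ::
  "(complex \<Rightarrow> complex^'n^'p) \<Rightarrow> (complex \<Rightarrow> complex^'n^'n) \<Rightarrow> (complex \<Rightarrow> complex^'m^'n)
    \<Rightarrow> complex \<Rightarrow> complex^'m^'p" where
  "transfer_function C K B = (\<lambda>s. C s ** matrix_inv (K s) ** B s)"

text \<open>
  Orthogonality refers to the unconjugated pairing \<open>x\<^sup>T y\<close>, not to the Hermitian inner product
  (nor to the real inner product \<open>x \<bullet> y\<close> of the type class).
\<close>

definition bilinear_dot :: "complex^'n \<Rightarrow> complex^'n \<Rightarrow> complex" where
  "bilinear_dot x y = (\<Sum>i\<in>UNIV. x $ i * y $ i)"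

definition bilinear_perp :: "(complex^'n) set \<Rightarrow> (complex^'n) set" where
  "bilinear_perp S = {y. \<forall>x\<in>S. bilinear_dot x y = 0}"

definition matrix_of_cols :: "('r \<Rightarrow> complex^'n) \<Rightarrow> complex^'r^'n" where
  "matrix_of_cols u = (\<chi> i j. u j $ i)"

text \<open>
  \<open>V\<close>, \<open>W\<close> are the matrices of inexact solutions, \<open>Rb\<close>, \<open>Rc\<close> those of the residuals.
\<close>

definition backward_perturbation ::
  "complex^'r^'n \<Rightarrow> complex^'r^'n \<Rightarrow> complex^'r^'n \<Rightarrow> complex^'r^'n \<Rightarrow> complex^'n^'n" where
  "backward_perturbation V W Rb Rc =
     Rb ** matrix_inv (transpose W ** V) ** transpose W
     + V ** matrix_inv (transpose W ** V) ** transpose Rc"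

end

theory Submission
  imports Defs
begin

text \<open>
  With \<open>X = (K - F)\<^sup>-\<^sup>1 B\<close>, the resolvent identity gives
  \<open>H - H' = - (C K\<^sup>-\<^sup>1) F X\<close>, and \<open>X = K\<^sup>-\<^sup>1 B + K\<^sup>-\<^sup>1 F X\<close>
  gives \<open>(1 - \<parallel>K\<^sup>-\<^sup>1\<parallel> \<parallel>F\<parallel>) \<parallel>X\<parallel> \<le> \<parallel>K\<^sup>-\<^sup>1 B\<parallel>\<close> on the imaginary axis.
  The estimate follows by integrating the square of
  \<open>\<parallel>A Y\<parallel>\<^sub>F \<le> \<parallel>A\<parallel>\<^sub>F \<parallel>Y\<parallel>\<close>.
\<close>

section \<open>Matrix inverses and distributivity\<close>

lemma matrix_inv_invertible:
  fixes A :: "'a::semiring_1^'n^'m"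
  assumes "invertible A"
  shows "A ** matrix_inv A = mat 1" "matrix_inv A ** A = mat 1"
proof -
  have "A ** matrix_inv A = mat 1 \<and> matrix_inv A ** A = mat 1"
    unfolding matrix_inv_def using assms unfolding invertible_def by (rule someI_ex)
  then show "A ** matrix_inv A = mat 1" "matrix_inv A ** A = mat 1"
    by auto
qed

lemma matrix_minus_ldistrib: "A ** (B - C) = A ** B - A ** C"
  for A :: "'a::ring_1^'n^'m"
  by (vector matrix_matrix_mult_def sum_subtractf right_diff_distrib)

lemma matrix_minus_rdistrib: "(A - B) ** C = A ** C - B ** C"
  for A :: "'a::ring_1^'n^'m"
  by (vector matrix_matrix_mult_def sum_subtractf left_diff_distrib)

section \<open>Inequalities for the spectral and Frobenius norms\<close>

lemma norm_matrix_vector_mult_le: "norm (A *v x) \<le> spectral_norm A * norm x"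
  unfolding spectral_norm_def by (rule onorm) simp

lemma spectral_norm_nonneg: "0 \<le> spectral_norm A"
  unfolding spectral_norm_def by (rule onorm_pos_le) simp

lemma spectral_norm_le:
  assumes "\<And>x. norm (A *v x) \<le> k * norm x"
  shows "spectral_norm A \<le> k"
  unfolding spectral_norm_def using assms by (rule onorm_le)

lemma spectral_norm_mult_le: "spectral_norm (A ** B) \<le> spectral_norm A * spectral_norm B"
proof (rule spectral_norm_le)
  fix x
  have "norm ((A ** B) *v x) \<le> spectral_norm A * norm (B *v x)"
    by (simp add: norm_matrix_vector_mult_le flip: matrix_vector_mul_assoc)
  also have "\<dots> \<le> spectral_norm A * (spectral_norm B * norm x)"
    by (intro mult_left_mono norm_matrix_vector_mult_le spectral_norm_nonneg)
  finally show "norm ((A ** B) *v x) \<le> spectral_norm A * spectral_norm B * norm x"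
    by (simp add: mult.assoc)
qed

lemma norm_bilinear_dot_le: "norm (bilinear_dot x y) \<le> norm x * norm y"
proof -
  have "norm (bilinear_dot x y) \<le> (\<Sum>i\<in>UNIV. \<bar>cmod (x $ i)\<bar> * \<bar>cmod (y $ i)\<bar>)"
    unfolding bilinear_dot_def by (rule sum_norm_le) (simp add: norm_mult)
  also have "\<dots> \<le> norm x * norm y"
    unfolding norm_vec_def by (rule L2_set_mult_ineq)
  finally show ?thesis .
qed

lemma bilinear_dot_transpose: "bilinear_dot (transpose A *v x) y = bilinear_dot x (A *v y)"
proof -
  have "bilinear_dot (transpose A *v x) y = (\<Sum>i\<in>UNIV. \<Sum>j\<in>UNIV. A $ j $ i * x $ j * y $ i)"
    by (simp add: bilinear_dot_def matrix_vector_mult_def transpose_def sum_distrib_right)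
  also have "\<dots> = (\<Sum>j\<in>UNIV. \<Sum>i\<in>UNIV. A $ j $ i * x $ j * y $ i)"
    by (rule sum.swap)
  also have "\<dots> = bilinear_dot x (A *v y)"
    by (simp add: bilinear_dot_def matrix_vector_mult_def sum_distrib_left mult_ac)
  finally show ?thesis .
qed

text \<open>Duality under the unconjugated pairing: pair \<open>y = transpose A *v x\<close> with
  its own conjugate, move \<open>A\<close> to the other side, and cancel one factor
  \<open>norm y\<close>.\<close>

lemma norm_transpose_mult_le: "norm (transpose A *v x) \<le> spectral_norm A * norm x"
proof -
  define y where "y = transpose A *v x"
  \<comment> \<open>Conjugating the entries turns the bilinear pairing into the Hermitian square of
    \<open>y\<close> without changing the norm.\<close>
  define z where "z = (\<chi> i. cnj (y $ i))"
  have z: "norm z = norm y"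
    by (simp add: norm_vec_def z_def)
  have "bilinear_dot y z = complex_of_real ((norm y)\<^sup>2)"
    by (simp add: bilinear_dot_def z_def norm_vec_def L2_set_def sum_nonneg
        flip: complex_norm_square)
  then have "norm y * norm y = norm (bilinear_dot y z)"
    by (simp add: power2_eq_square norm_mult)
  also have "\<dots> = norm (bilinear_dot x (A *v z))"
    by (simp add: y_def bilinear_dot_transpose del: transpose_matrix_vector)
  also have "\<dots> \<le> norm x * norm (A *v z)"
    by (rule norm_bilinear_dot_le)
  also have "\<dots> \<le> norm x * (spectral_norm A * norm y)"
    using norm_matrix_vector_mult_le[of A z] by (intro mult_left_mono) (simp_all add: z)
  finally have "norm y * norm y \<le> (spectral_norm A * norm x) * norm y"
    by (simp add: mult_ac)
  then have "norm y \<le> spectral_norm A * norm x"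
    by (cases "norm y = 0") (auto simp: spectral_norm_nonneg)
  then show ?thesis
    by (simp add: y_def)
qed

lemma frobenius_norm_eq_norm: "frobenius_norm A = norm A"
  by (simp add: frobenius_norm_def norm_vec_def L2_set_def sum_nonneg)

text \<open>The rows of the product are \<open>transpose B\<close> applied to the rows of
  \<open>A\<close>, and the Frobenius norm is the Euclidean norm of the row norms. This is why the
  bound for transposes is needed.\<close>

lemma norm_matrix_mult_le: "norm (A ** B) \<le> norm A * spectral_norm B"
  for A :: "complex^'n^'m" and B :: "complex^'k^'n"
proof -
  have row: "(A ** B) $ i = transpose B *v A $ i" for i
    by (simp add: vec_eq_iff matrix_matrix_mult_def matrix_vector_mult_def transpose_def mult.commute)
  have "norm (A ** B) \<le> L2_set (\<lambda>i. spectral_norm B * norm (A $ i)) UNIV"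
    unfolding norm_vec_def[of "A ** B"]
    by (rule L2_set_mono) (simp_all add: row norm_transpose_mult_le del: transpose_matrix_vector)
  also have "\<dots> = norm A * spectral_norm B"
    unfolding norm_vec_def[of A]
    by (simp add: L2_set_right_distrib spectral_norm_nonneg mult.commute)
  finally show ?thesis .
qed

lemma spectral_norm_le_Hinf_norm:
  assumes "Hinf_finite G"
  shows "spectral_norm (G (\<i> * of_real \<omega>)) \<le> Hinf_norm G"
  using assms unfolding Hinf_finite_def Hinf_norm_def by (intro cSUP_upper) auto

section \<open>Continuity of products, determinants and inverses\<close>

lemma continuous_on_matrix_mult:
  fixes A :: "'b::topological_space \<Rightarrow> complex^'n^'m"
  assumes "continuous_on S A" "continuous_on S B"
  shows "continuous_on S (\<lambda>s. A s ** B s)"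
  unfolding matrix_matrix_mult_def using assms by (intro continuous_intros)

lemma continuous_on_det:
  fixes A :: "'b::topological_space \<Rightarrow> complex^'n^'n"
  assumes "continuous_on S A"
  shows "continuous_on S (\<lambda>s. det (A s))"
  unfolding det_def using assms by (intro continuous_intros)

text \<open>Column \<open>l\<close> of the inverse solves \<open>A *v x = column l (mat 1)\<close>,
  so Cramer's rule applies. The formula exhibits every entry as a quotient of polynomials in the
  entries of \<open>A\<close>, which yields continuity of inversion.\<close>

lemma matrix_inv_cramer:
  fixes A :: "'a::field^'n^'n"
  assumes "invertible A"
  shows "matrix_inv A =
    (\<chi> k l. det (\<chi> i j. if j = k then mat 1 $ i $ l else A $ i $ j) / det A)"
proof -
  have "A *v column l (matrix_inv A) = column l (mat 1)" for l
    by (simp add: matrix_vector_mult_def column_def vec_eq_iff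
        flip: matrix_inv_invertible(1)[OF assms])
      (simp add: matrix_matrix_mult_def)
  then have "column l (matrix_inv A) =
      (\<chi> k. det (\<chi> i j. if j = k then column l (mat 1) $ i else A $ i $ j) / det A)" for l
    using assms by (simp add: cramer invertible_det_nz)
  then show ?thesis
    by (simp add: vec_eq_iff column_def cong: if_cong)
qed

lemma continuous_on_matrix_inv:
  fixes A :: "'b::topological_space \<Rightarrow> complex^'n^'n"
  assumes A: "continuous_on S A" and inv: "\<And>s. s \<in> S \<Longrightarrow> invertible (A s)"
  shows "continuous_on S (\<lambda>s. matrix_inv (A s))"
proof -
  \<comment> \<open>The condition \<open>j = k\<close> does not depend on \<open>s\<close>: each
    entry is either constant or an entry of \<open>A s\<close>.\<close>
  have "continuous_on S (\<lambda>s. if j = k then mat 1 $ i $ l else A s $ i $ j)" for i j k l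
    using A by (cases "j = k") (simp_all add: continuous_on_component)
  then have "continuous_on S
      (\<lambda>s. \<chi> k l. det (\<chi> i j. if j = k then mat 1 $ i $ l else A s $ i $ j) / det (A s))"
    using inv by (intro continuous_intros continuous_on_det A) (auto simp: invertible_det_nz)
  then show ?thesis
    by (rule continuous_on_eq) (simp add: matrix_inv_cramer inv)
qed

section \<open>Small perturbations of an invertible matrix\<close>

lemma invertible_diff_small:
  fixes K F :: "complex^'n^'n"
  assumes K: "invertible K" and small: "spectral_norm (matrix_inv K) * spectral_norm F < 1"
  shows "invertible (K - F)"
proof -
  \<comment> \<open>Trivial kernel suffices for a square matrix. A kernel vector satisfies
    \<open>K *v x = F *v x\<close>, hence is a fixed point of \<open>matrix_inv K ** F\<close>,
    whose norm is below 1.\<close>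
  have "x = 0" if x: "(K - F) *v x = 0" for x
  proof -
    have "x = matrix_inv K *v (K *v x)"
      by (simp add: matrix_vector_mul_assoc matrix_inv_invertible[OF K])
    also have "K *v x = F *v x"
      using x by (simp add: matrix_vector_mult_diff_rdistrib)
    finally have "norm x = norm ((matrix_inv K ** F) *v x)"
      by (simp add: matrix_vector_mul_assoc)
    also have "\<dots> \<le> spectral_norm (matrix_inv K ** F) * norm x"
      by (rule norm_matrix_vector_mult_le)
    also have "\<dots> \<le> (spectral_norm (matrix_inv K) * spectral_norm F) * norm x"
      by (intro mult_right_mono spectral_norm_mult_le) simp
    finally show "x = 0"
      using small by (metis mult_le_cancel_right1 not_le norm_le_zero_iff)
  qed
  then show ?thesis
    by (simp add: invertible_left_inverse matrix_left_invertible_ker)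
qed

text \<open>Write the middle factor \<open>F\<close> as \<open>K - (K - F)\<close>; each term then
  cancels against one of the two inverses.\<close>

lemma matrix_inv_diff_resolvent:
  fixes K F :: "'a::field^'n^'n"
  assumes K: "invertible K" and KF: "invertible (K - F)"
  shows "matrix_inv (K - F) - matrix_inv K = matrix_inv K ** F ** matrix_inv (K - F)"
proof -
  have "matrix_inv K ** F ** matrix_inv (K - F)
      = matrix_inv K ** (K - (K - F)) ** matrix_inv (K - F)"
    by simp
  also have "\<dots> = matrix_inv K ** K ** matrix_inv (K - F)
      - matrix_inv K ** ((K - F) ** matrix_inv (K - F))"
    by (simp only: matrix_minus_ldistrib matrix_minus_rdistrib matrix_mul_assoc)
  also have "\<dots> = matrix_inv (K - F) - matrix_inv K"
    by (simp add: matrix_inv_invertible K KF)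
  finally show ?thesis ..
qed

text \<open>The resolvent identity gives a fixed-point equation for the perturbed solution. Its own
  norm on the right has a coefficient below 1 and is absorbed into the left side, so no Neumann
  series is summed.\<close>

lemma spectral_norm_perturbed_solution_le:
  fixes K F :: "complex^'n^'n" and B :: "complex^'m^'n"
  assumes K: "invertible K" and small: "spectral_norm (matrix_inv K) * spectral_norm F < 1"
  shows "spectral_norm (matrix_inv (K - F) ** B)
    \<le> spectral_norm (matrix_inv K ** B) / (1 - spectral_norm (matrix_inv K) * spectral_norm F)"
proof (rule spectral_norm_le)
  fix x
  let ?\<kappa> = "spectral_norm (matrix_inv K) * spectral_norm F"
  define y where "y = (matrix_inv (K - F) ** B) *v x"
  have "matrix_inv (K - F) = matrix_inv K + matrix_inv K ** F ** matrix_inv (K - F)"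
    using matrix_inv_diff_resolvent[OF K invertible_diff_small[OF K small]]
    by (simp add: algebra_simps)
  then have "matrix_inv (K - F) *v (B *v x)
      = (matrix_inv K + matrix_inv K ** F ** matrix_inv (K - F)) *v (B *v x)"
    by simp
  then have "y = (matrix_inv K ** B) *v x + (matrix_inv K ** F) *v y"
    by (simp add: y_def matrix_vector_mult_add_rdistrib flip: matrix_vector_mul_assoc)
  then have "norm y \<le> norm ((matrix_inv K ** B) *v x) + norm ((matrix_inv K ** F) *v y)"
    by (metis norm_triangle_ineq)
  also have "\<dots> \<le> spectral_norm (matrix_inv K ** B) * norm x + ?\<kappa> * norm y"
    by (intro add_mono norm_matrix_vector_mult_le order_trans[OF norm_matrix_vector_mult_le]
        mult_right_mono spectral_norm_mult_le) simp
  finally have "norm y * (1 - ?\<kappa>) \<le> spectral_norm (matrix_inv K ** B) * norm x"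
    by (simp add: algebra_simps)
  then show "norm ((matrix_inv (K - F) ** B) *v x)
      \<le> spectral_norm (matrix_inv K ** B) / (1 - ?\<kappa>) * norm x"
    using small by (simp add: y_def field_simps)
qed

section \<open>From pointwise bounds on the axis to the \<open>H2_norm\<close>\<close>

lemma H2_norm_le_of_pointwise:
  assumes A: "H2_finite A" and M: "0 \<le> M"
    and meas: "(\<lambda>\<omega>. G (\<i> * of_real \<omega>)) \<in> borel_measurable borel"
    and le: "\<And>\<omega>. norm (G (\<i> * of_real \<omega>)) \<le> norm (A (\<i> * of_real \<omega>)) * M"
  shows "H2_finite G" "H2_norm G \<le> H2_norm A * M"
proof -
  let ?g = "\<lambda>\<omega>::real. (norm (G (\<i> * of_real \<omega>)))\<^sup>2"
  let ?a = "\<lambda>\<omega>::real. (norm (A (\<i> * of_real \<omega>)))\<^sup>2"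
  have le2: "?g \<omega> \<le> ?a \<omega> * M\<^sup>2" for \<omega>
    using power_mono[OF le[of \<omega>], of 2] by (simp add: power_mult_distrib)
  have a: "integrable lborel (\<lambda>\<omega>. ?a \<omega> * M\<^sup>2)"
    using A by (simp add: H2_finite_def frobenius_norm_eq_norm)
  \<comment> \<open>Domination yields integrability only for a measurable integrand, hence the
    premise \<open>meas\<close>.\<close>
  have g: "integrable lborel ?g"
    by (rule Bochner_Integration.integrable_bound[OF a]) (use meas le2 in auto)
  then show "H2_finite G"
    by (simp add: H2_finite_def frobenius_norm_eq_norm)
  have "(LINT \<omega>|lborel. ?g \<omega>) \<le> (LINT \<omega>|lborel. ?a \<omega>) * M\<^sup>2"
    using integral_mono[OF g a] le2 by simp
  then have "H2_norm G \<le> sqrt (1 / (2 * pi) * ((LINT \<omega>|lborel. ?a \<omega>) * M\<^sup>2))"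
    by (simp add: H2_norm_def frobenius_norm_eq_norm divide_right_mono)
  also have "\<dots> = sqrt (1 / (2 * pi) * (LINT \<omega>|lborel. ?a \<omega>)) * sqrt (M\<^sup>2)"
    by (simp only: mult.assoc flip: real_sqrt_mult)
  also have "\<dots> = H2_norm A * M"
    using M by (simp add: H2_norm_def frobenius_norm_eq_norm)
  finally show "H2_norm G \<le> H2_norm A * M" .
qed

text \<open>Finiteness belongs to the conclusion because the integral in \<open>H2_norm\<close>
  defaults to 0 when the integrand is not integrable; the inequality alone would then say
  nothing.\<close>

theorem theorem4p3:
  fixes K :: "complex \<Rightarrow> complex^'n^'n"
    and B :: "complex \<Rightarrow> complex^'m^'n"
    and C :: "complex \<Rightarrow> complex^'n^'p"
    and \<sigma> :: "'r::finite \<Rightarrow> complex"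
    and b :: "'r \<Rightarrow> complex^'m"
    and c :: "'r \<Rightarrow> complex^'p"
    and P Q :: "(complex^'n) set"
    and N :: nat
    and v w \<eta> \<xi> :: "'r \<Rightarrow> complex^'n"
    and V W Rb Rc :: "complex^'r^'n"
    and F :: "complex^'n^'n"
    and H H' :: "complex \<Rightarrow> complex^'m^'p"
  assumes K_an: "analytic_rhp_cont_axis K"
    and B_an: "analytic_rhp_cont_axis B"
    and C_an: "analytic_rhp_cont_axis C"
    and K_inv: "\<And>s. Re s = 0 \<Longrightarrow> invertible (K s)"
    and CK_fin: "H2_finite (\<lambda>s. C s ** matrix_inv (K s))"
    and KB_fin: "Hinf_finite (\<lambda>s. matrix_inv (K s) ** B s)"
    and K_fin: "Hinf_finite (\<lambda>s. matrix_inv (K s))"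
    and K_sigma: "\<And>j. invertible (K (\<sigma> j))"
    and P: "vec.subspace P" "vec.dim P = N"
    and Q: "vec.subspace Q" "vec.dim Q = N"
    and PQ: "\<And>j. bilinear_perp ((*v) (K (\<sigma> j)) ` P) \<inter> Q = {0}"
    and v: "\<And>j. v j \<in> P"
    and eta: "\<And>j. \<eta> j = K (\<sigma> j) *v v j - B (\<sigma> j) *v b j"
    and eta_perp: "\<And>j. \<eta> j \<in> bilinear_perp Q"
    and w: "\<And>j. w j \<in> Q"
    and xi: "\<And>j. \<xi> j = transpose (K (\<sigma> j)) *v w j - transpose (C (\<sigma> j)) *v c j"
    and xi_perp: "\<And>j. \<xi> j \<in> bilinear_perp P"
    and V: "V = matrix_of_cols v"
    and W: "W = matrix_of_cols w"
    and Rb: "Rb = matrix_of_cols \<eta>"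
    and Rc: "Rc = matrix_of_cols \<xi>"
    and WV: "invertible (transpose W ** V)"
    and F: "F = backward_perturbation V W Rb Rc"
    and H: "H = transfer_function C K B"
    and H': "H' = transfer_function C (\<lambda>s. K s - F) B"
    and small: "spectral_norm F < 1 / Hinf_norm (\<lambda>s. matrix_inv (K s))"
  shows "H2_finite (\<lambda>s. H s - H' s) \<and>
    H2_norm (\<lambda>s. H s - H' s)
      \<le> H2_norm (\<lambda>s. C s ** matrix_inv (K s)) * Hinf_norm (\<lambda>s. matrix_inv (K s) ** B s)
         / (1 - Hinf_norm (\<lambda>s. matrix_inv (K s)) * spectral_norm F)
         * spectral_norm F"
proof -
  define KI where "KI = (\<lambda>s. matrix_inv (K s))"
  define X where "X = (\<lambda>s. matrix_inv (K s - F) ** B s)"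
  let ?f = "spectral_norm F" and ?\<kappa> = "Hinf_norm KI" and ?h = "Hinf_norm (\<lambda>s. KI s ** B s)"
  have fin: "Hinf_finite KI" "Hinf_finite (\<lambda>s. KI s ** B s)"
    using K_fin KB_fin by (simp_all add: KI_def)
  have KI_le: "spectral_norm (KI (\<i> * of_real \<omega>)) \<le> ?\<kappa>" for \<omega>
    by (rule spectral_norm_le_Hinf_norm[OF fin(1)])
  have \<kappa>: "0 \<le> ?\<kappa>"
    using KI_le spectral_norm_nonneg order_trans by blast
  \<comment> \<open>If \<open>?\<kappa> = 0\<close>, then \<open>1 / ?\<kappa> = 0\<close> and the smallness hypothesis is contradictory.\<close>
  have \<kappa>f: "?\<kappa> * ?f < 1"
    using small \<kappa> spectral_norm_nonneg[of F]
    by (cases "?\<kappa> = 0") (simp_all add: KI_def[symmetric] field_simps)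
  have mult_le: "spectral_norm (KI (\<i> * of_real \<omega>)) * ?f \<le> ?\<kappa> * ?f" for \<omega>
    by (intro mult_right_mono KI_le spectral_norm_nonneg)
  have K_axis: "invertible (K (\<i> * of_real \<omega>))" for \<omega>
    by (rule K_inv) simp
  \<comment> \<open>The supremum dominates each value on the axis, so smallness holds pointwise and
    \<open>K s - F\<close> is invertible along the whole axis.\<close>
  have small_axis: "spectral_norm (matrix_inv (K (\<i> * of_real \<omega>))) * ?f < 1" for \<omega>
    using mult_le[of \<omega>] \<kappa>f by (simp add: KI_def)
  note KF_axis = invertible_diff_small[OF K_axis small_axis]
  have h_le: "spectral_norm (KI (\<i> * of_real \<omega>) ** B (\<i> * of_real \<omega>)) \<le> ?h" for \<omega>
    by (rule spectral_norm_le_Hinf_norm[OF fin(2)])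
  have h: "0 \<le> ?h"
    using h_le spectral_norm_nonneg order_trans by blast
  have X_le: "spectral_norm (X (\<i> * of_real \<omega>)) \<le> ?h / (1 - ?\<kappa> * ?f)" for \<omega>
  proof -
    have "spectral_norm (X (\<i> * of_real \<omega>)) \<le>
        spectral_norm (KI (\<i> * of_real \<omega>) ** B (\<i> * of_real \<omega>))
          / (1 - spectral_norm (KI (\<i> * of_real \<omega>)) * ?f)"
      unfolding X_def KI_def by (rule spectral_norm_perturbed_solution_le[OF K_axis small_axis])
    \<comment> \<open>Passing to suprema enlarges the numerator and shrinks the denominator, which
      stays positive by \<open>\<kappa>f\<close>.\<close>
    also have "\<dots> \<le> ?h / (1 - ?\<kappa> * ?f)"
      using h h_le mult_le[of \<omega>] \<kappa>f by (intro frac_le) auto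
    finally show ?thesis .
  qed
  \<comment> \<open>Restricted to the axis, where both inverses are known to exist. The sign comes
    from applying the resolvent identity to \<open>H' - H\<close>, and it vanishes under the
    norm.\<close>
  have diff: "H s - H' s = - ((C s ** KI s) ** (F ** X s))" if "s = \<i> * of_real \<omega>" for s \<omega>
  proof -
    have "H' s - H s = C s ** (matrix_inv (K s - F) - matrix_inv (K s)) ** B s"
      by (simp add: H H' transfer_function_def matrix_minus_ldistrib matrix_minus_rdistrib)
    also have "\<dots> = (C s ** KI s) ** (F ** X s)"
      using K_axis[of \<omega>] KF_axis[of \<omega>] that
      by (simp add: matrix_inv_diff_resolvent KI_def X_def matrix_mul_assoc)
    finally show ?thesis
      by (metis minus_diff_eq)
  qed
  have axis: "continuous_on UNIV (\<lambda>\<omega>::real. G (\<i> * of_real \<omega>))"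
    if "analytic_rhp_cont_axis G" for G :: "complex \<Rightarrow> complex^'j^'i"
    using that unfolding analytic_rhp_cont_axis_def
    by (intro continuous_on_compose2[of "{s. Re s = 0}" G UNIV "\<lambda>\<omega>. \<i> * of_real \<omega>"])
      (auto intro!: continuous_intros)
  \<comment> \<open>Serves only to supply measurability; continuity of the perturbed inverse rests
    on \<open>KF_axis\<close>.\<close>
  have "continuous_on UNIV (\<lambda>\<omega>::real. H (\<i> * of_real \<omega>) - H' (\<i> * of_real \<omega>))"
    unfolding H H' transfer_function_def
    by (intro continuous_on_diff continuous_on_matrix_mult continuous_on_matrix_inv
        continuous_on_const axis K_an B_an C_an K_axis KF_axis)
  then have meas: "(\<lambda>\<omega>::real. H (\<i> * of_real \<omega>) - H' (\<i> * of_real \<omega>)) \<in> borel_measurable borel"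
    by (rule borel_measurable_continuous_onI)
  \<comment> \<open>A bound for the spectral norm of \<open>F ** X s\<close> on the axis:
    \<open>?f\<close> bounds \<open>F\<close>, and the quotient bounds \<open>X s\<close>.\<close>
  let ?M = "?f * (?h / (1 - ?\<kappa> * ?f))"
  have M: "0 \<le> ?M"
    using h \<kappa>f by (simp add: spectral_norm_nonneg)
  have "norm (H (\<i> * of_real \<omega>) - H' (\<i> * of_real \<omega>))
      \<le> norm (C (\<i> * of_real \<omega>) ** KI (\<i> * of_real \<omega>)) * ?M" for \<omega>
  proof -
    have "spectral_norm (F ** X (\<i> * of_real \<omega>)) \<le> ?M"
      by (rule order_trans[OF spectral_norm_mult_le])
        (intro mult_left_mono X_le spectral_norm_nonneg)
    then show ?thesis
      unfolding diff[OF refl] norm_minus_cancel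
      by (intro order_trans[OF norm_matrix_mult_le] mult_left_mono) simp_all
  qed
  from H2_norm_le_of_pointwise[where A = "\<lambda>s. C s ** KI s" and G = "\<lambda>s. H s - H' s",
      OF _ M meas this] CK_fin
  show ?thesis
    by (simp add: KI_def mult_ac)
qed

end
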